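(* Let $F\in C^2(\mathbb R^n\times\mathbb R^m,\mathbb R)$, let $(x^\star,z^\star)$ be a saddle point of $F$ solving $\max_{z\in\mathbb R^m}\min_{x\in\mathbb R^n}F(x,z)$, and suppose that $F$ is locally strongly convex-concave on an open neighborhood $U\subset\mathbb R^n\times\mathbb R^m$ of $(x^\star,z^\star)$, i.e., there exist $k_x,k_z>0$ such that $\nabla_{xx}F(x,z)\succeq k_xI$ and $\nabla_{zz}F(x,z)\preceq-k_zI$ for all $(x,z)\in U$. Let $c_1,c_2>0$, $p_1>2$, $1<p_2<2$, and consider $$\begin{bmatrix}\dot x\\ \dot z\end{bmatrix}=-c_1\frac{\tilde\nabla F(x,z)}{\|\nabla F(x,z)\|^{\frac{p_1-2}{p_1-1}}}-c_2\frac{\tilde\nabla F(x,z)}{\|\nabla F(x,z)\|^{\frac{p_2-2}{p_2-1}}},\qquad \tilde\nabla F=\begin{bmatrix}\nabla_xF\\-\nabla_zF\end{bmatrix}.$$ Then the trajectories converge to the saddle point $(x^\star,z^\star)$ in a fixed time $T_{SP2}$ for all $(x(0),z(0))\in U$; that is, there is $T_{SP2}<\infty$, independent of the initial condition in $U$, such that $(x(t),z(t))=(x^\star,z^\star)$ for all $t\ge T_{SP2}$. If $U=\mathbb R^n\times\mathbb R^m$, then the result holds for all $(x(0),z(0))\in\mathbb R^n\times\mathbb R^m$.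
   Context: $\|\cdot\|$ is the Euclidean norm and $\nabla F=[\nabla_xF^T\ \ \nabla_zF^T]^T$. $(x^\star,z^\star)$ is a (local) saddle point if there are open neighborhoods $N_x$ of $x^\star$ and $N_z$ of $z^\star$ with $F(x^\star,z)\le F(x^\star,z^\star)\le F(x,z^\star)$ for all $(x,z)\in N_x\times N_z$; it is then also called a local optimal solution of the max-min problem. Locally strongly convex-concave on $U$ means: $U=U_x\times U_z$ with $U_x,U_z$ convex, for each fixed $\bar z\in U_z$ the function $F(\cdot,\bar z)$ is strongly convex on $U_x$, and for each fixed $\bar x\in U_x$ the function $F(\bar x,\cdot)$ is strongly concave on $U_z$. Convention: the right-hand side of the differential equation is defined to be $0$ where $\nabla F(x,z)=0$. A trajectory is a solution defined for $t\ge0$.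
   Formalization: For general U the claim is made only for trajectories that remain in U, or start in a ball around the saddle point contained in U; a trajectory starting in U may otherwise leave U and converge to another critical point. For U the whole space the claim is unrestricted. *)

theory Defs
  imports "HOL-Analysis.Analysis"
begin

definition gradient :: "('a::real_inner \<Rightarrow> real) \<Rightarrow> 'a \<Rightarrow> 'a"
  where "gradient f x = (THE D. GDERIV f x :> D)"

(* The second derivative is continuous direction by direction; in finite dimension this is
   the same as continuity in the operator norm, or of all second partial derivatives. *)
definition C2 :: "('a::euclidean_space \<Rightarrow> real) \<Rightarrow> bool"
  where "C2 f \<longleftrightarrow>
    (\<forall>x. f differentiable (at x)) \<and>
    (\<forall>x. gradient f differentiable (at x)) \<and>
    (\<forall>v. continuous_on UNIV (\<lambda>x. frechet_derivative (gradient f) (at x) v))"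

definition hessian :: "(real ^ 'n \<Rightarrow> real) \<Rightarrow> real ^ 'n \<Rightarrow> real ^ 'n ^ 'n"
  where "hessian f x = jacobian (gradient f) (at x)"

(* Comparison of quadratic forms. Symmetry is not part of the definition: it is applied to
   Hessians of C2 functions and to multiples of the identity only. *)
definition loewner_le :: "real ^ 'n ^ 'n \<Rightarrow> real ^ 'n ^ 'n \<Rightarrow> bool"
  where "loewner_le A B \<longleftrightarrow> (\<forall>v. v \<bullet> (A *v v) \<le> v \<bullet> (B *v v))"

definition local_saddle_point ::
  "('a::topological_space \<times> 'b::topological_space \<Rightarrow> real) \<Rightarrow> 'a \<Rightarrow> 'b \<Rightarrow> bool"
  where "local_saddle_point F xs zs \<longleftrightarrow>
    (\<exists>Nx Nz. open Nx \<and> open Nz \<and> xs \<in> Nx \<and> zs \<in> Nz \<and>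
      (\<forall>x\<in>Nx. \<forall>z\<in>Nz. F (xs, z) \<le> F (xs, zs) \<and> F (xs, zs) \<le> F (x, zs)))"

definition strongly_convex_on :: "'a::real_inner set \<Rightarrow> ('a \<Rightarrow> real) \<Rightarrow> bool"
  where "strongly_convex_on S f \<longleftrightarrow> convex S \<and>
    (\<exists>k>0. \<forall>x\<in>S. \<forall>y\<in>S. \<forall>u\<in>{0..1}.
      f ((1 - u) *\<^sub>R x + u *\<^sub>R y)
        \<le> (1 - u) * f x + u * f y - k / 2 * u * (1 - u) * (norm (x - y))\<^sup>2)"

definition strongly_concave_on :: "'a::real_inner set \<Rightarrow> ('a \<Rightarrow> real) \<Rightarrow> bool"
  where "strongly_concave_on S f \<longleftrightarrow> strongly_convex_on S (\<lambda>x. - f x)"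

definition strongly_convex_concave_on ::
  "('a::real_inner \<times> 'b::real_inner) set \<Rightarrow> ('a \<times> 'b \<Rightarrow> real) \<Rightarrow> bool"
  where "strongly_convex_concave_on U F \<longleftrightarrow>
    (\<exists>Ux Uz. U = Ux \<times> Uz \<and> convex Ux \<and> convex Uz \<and>
      (\<forall>z\<in>Uz. strongly_convex_on Ux (\<lambda>x. F (x, z))) \<and>
      (\<forall>x\<in>Ux. strongly_concave_on Uz (\<lambda>z. F (x, z))))"

definition grad_x :: "('a::real_inner \<times> 'b::real_inner \<Rightarrow> real) \<Rightarrow> 'a \<times> 'b \<Rightarrow> 'a"
  where "grad_x F p = gradient (\<lambda>x. F (x, snd p)) (fst p)"

definition grad_z :: "('a::real_inner \<times> 'b::real_inner \<Rightarrow> real) \<Rightarrow> 'a \<times> 'b \<Rightarrow> 'b"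
  where "grad_z F p = gradient (\<lambda>z. F (fst p, z)) (snd p)"

definition full_grad :: "('a::real_inner \<times> 'b::real_inner \<Rightarrow> real) \<Rightarrow> 'a \<times> 'b \<Rightarrow> 'a \<times> 'b"
  where "full_grad F p = (grad_x F p, grad_z F p)"

definition saddle_grad :: "('a::real_inner \<times> 'b::real_inner \<Rightarrow> real) \<Rightarrow> 'a \<times> 'b \<Rightarrow> 'a \<times> 'b"
  where "saddle_grad F p = (grad_x F p, - grad_z F p)"

definition saddle_flow_field ::
  "real \<Rightarrow> real \<Rightarrow> real \<Rightarrow> real \<Rightarrow> ('a::real_inner \<times> 'b::real_inner \<Rightarrow> real)
    \<Rightarrow> 'a \<times> 'b \<Rightarrow> 'a \<times> 'b"
  where "saddle_flow_field c1 c2 p1 p2 F p =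
    (if full_grad F p = 0 then 0
     else - ((c1 / norm (full_grad F p) powr ((p1 - 2) / (p1 - 1))) *\<^sub>R saddle_grad F p)
          - ((c2 / norm (full_grad F p) powr ((p2 - 2) / (p2 - 1))) *\<^sub>R saddle_grad F p))"

(* Values of w at negative times are irrelevant; at time 0 the derivative is one-sided. *)
definition trajectory :: "('a::real_normed_vector \<Rightarrow> 'a) \<Rightarrow> (real \<Rightarrow> 'a) \<Rightarrow> bool"
  where "trajectory f w \<longleftrightarrow>
    (\<forall>t\<ge>0. (w has_vector_derivative f (w t)) (at t within {0..}))"

end

theory Submission
  imports Defs
begin

text \<open>
  The squared distance to the saddle point \<open>p\<^sub>0\<close> is a Lyapunov function for the flow, and a single
  one serves for all three claims. Write \<open>n = \<parallel>\<nabla>F\<parallel>\<close>, let \<open>g\<close> be \<open>\<nabla>F\<close> with its \<open>z\<close>-block negated,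
  \<open>D\<close> the distance to \<open>p\<^sub>0\<close>, \<open>k = min k\<^sub>x k\<^sub>z\<close>, and
  \<open>a = (p\<^sub>1 - 2)/(p\<^sub>1 - 1) \<in> (0,1)\<close>, \<open>b = (p\<^sub>2 - 2)/(p\<^sub>2 - 1) < 0\<close>.

  The second-order Taylor bounds for \<open>F(\<cdot>,z)\<close> and \<open>F(x,\<cdot>)\<close> add up to the coercivity estimate
  \<open>k D\<^sup>2 \<le> (p - p\<^sub>0) \<bullet> g\<close> on \<open>U\<close> (lemma \<open>saddle_grad_coercive\<close>). It compares values of \<open>F\<close> at the four
  corners \<open>(x,z)\<close>, \<open>(x\<^sub>0,z)\<close>, \<open>(x,z\<^sub>0)\<close>, \<open>(x\<^sub>0,z\<^sub>0)\<close> along the edges of the rectangle, each of which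
  varies one block of variables only.

  Along the flow \<open>D D' = - (c\<^sub>1 n\<^sup>-\<^sup>a + c\<^sub>2 n\<^sup>-\<^sup>b) (p - p\<^sub>0) \<bullet> g\<close>. Both terms are nonpositive, so each may be
  dropped in turn. Coercivity also gives \<open>n \<ge> k D\<close>, and since \<open>-b > 0\<close> the second term forces
  \<open>D D' \<le> - \<kappa>\<^sub>2 D\<^sup>2\<^sup>-\<^sup>b\<close> with \<open>\<kappa>\<^sub>2 > 0\<close>: a superlinear decay that brings any initial distance below a
  given radius within a time that does not depend on it. Near \<open>p\<^sub>0\<close> differentiability of \<open>\<nabla>F\<close> gives
  \<open>n \<le> L D\<close>, and since \<open>a > 0\<close> the first term forces \<open>D D' \<le> - \<kappa>\<^sub>1 D\<^sup>2\<^sup>-\<^sup>a\<close> with \<open>\<kappa>\<^sub>1 > 0\<close>, which reaches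
  zero in finite time (lemma \<open>fixed_time_extinction\<close>). Monotonicity of \<open>D\<close> keeps the trajectory at
  \<open>p\<^sub>0\<close> afterwards, and makes every ball about \<open>p\<^sub>0\<close> inside \<open>U\<close> forward invariant (lemma
  \<open>ball_invariant\<close>).
\<close>

section \<open>Gradients, partial gradients and Hessians\<close>

lemma GDERIV_unique:
  assumes "GDERIV f x :> D" "GDERIV f x :> E"
  shows "D = E"
proof -
  have "(\<lambda>h. h \<bullet> D) = (\<lambda>h. h \<bullet> E)"
    using assms unfolding gderiv_def by (rule has_derivative_unique)
  then have "(D - E) \<bullet> D = (D - E) \<bullet> E" by meson
  then have "(D - E) \<bullet> (D - E) = 0" by (simp add: inner_diff_right)
  then show ?thesis by simp
qed

lemma gradient_eqI: "GDERIV f x :> D \<Longrightarrow> gradient f x = D"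
  unfolding gradient_def by (blast intro: the_equality GDERIV_unique)

lemma differentiable_imp_GDERIV_gradient:
  fixes f :: "'a::euclidean_space \<Rightarrow> real"
  assumes "f differentiable (at x)"
  shows "GDERIV f x :> gradient f x"
proof -
  obtain f' where f': "(f has_derivative f') (at x)"
    using assms unfolding differentiable_def by blast
  (* Riesz representation of the derivative: its representing vector is the adjoint at 1. *)
  define D where "D = adjoint f' 1"
  have "f' = (\<lambda>h. h \<bullet> D)"
    using adjoint_works[OF has_derivative_linear[OF f'], where y = 1] by (simp add: D_def fun_eq_iff)
  with f' have "GDERIV f x :> D" by (simp add: gderiv_def)
  with gradient_eqI[OF this] show ?thesis by simp
qed

lemma GDERIV_fst:
  assumes "GDERIV F (x, z) :> D"
  shows "GDERIV (\<lambda>x'. F (x', z)) x :> fst D"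
proof -
  have "((\<lambda>x'. (x', z)) has_derivative (\<lambda>h. (h, 0))) (at x)"
    by (auto intro!: derivative_eq_intros)
  from has_derivative_compose[OF this, of F "\<lambda>h. h \<bullet> D"] assms
  show ?thesis unfolding gderiv_def by (simp add: inner_prod_def)
qed

lemma GDERIV_snd:
  assumes "GDERIV F (x, z) :> D"
  shows "GDERIV (\<lambda>z'. F (x, z')) z :> snd D"
proof -
  have "((\<lambda>z'. (x, z')) has_derivative (\<lambda>h. (0, h))) (at z)"
    by (auto intro!: derivative_eq_intros)
  from has_derivative_compose[OF this, of F "\<lambda>h. h \<bullet> D"] assms
  show ?thesis unfolding gderiv_def by (simp add: inner_prod_def)
qed

lemma full_grad_eq_gradient:
  assumes "GDERIV F p :> gradient F p"
  shows "full_grad F p = gradient F p"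
proof -
  from assms have "GDERIV F (fst p, snd p) :> gradient F p" by simp
  from gradient_eqI[OF GDERIV_fst[OF this]] gradient_eqI[OF GDERIV_snd[OF this]]
  show ?thesis
    by (simp add: full_grad_def grad_x_def grad_z_def)
qed

lemma norm_saddle_grad: "norm (saddle_grad F p) = norm (full_grad F p)"
  by (simp add: saddle_grad_def full_grad_def norm_Pair)

lemma hessian_mult_vec:
  assumes G: "\<And>x. GDERIV f x :> G x" and "(G has_derivative G') (at x)"
  shows "hessian f x *v v = G' v"
proof -
  have "gradient f = G" using gradient_eqI[OF G] by blast
  moreover have "frechet_derivative G (at x) = G'"
    using frechet_derivative_at[OF assms(2)] by simp
  ultimately show ?thesis
    unfolding hessian_def jacobian_def
    using matrix_works[of G' v] has_derivative_linear[OF assms(2)]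
    by (simp add: linear_matrix_vector_mul_eq)
qed

lemma mat_mult_vec: "mat k *v (v :: real ^ 'n) = k *\<^sub>R v"
  by (simp add: vec_eq_iff matrix_vector_mult_def mat_def if_distrib[where f="\<lambda>a. a * _"] cong: if_cong)

lemma local_min_imp_GDERIV_zero:
  assumes "open N" "x \<in> N" "\<And>y. y \<in> N \<Longrightarrow> f x \<le> f y" "GDERIV f x :> D"
  shows "D = 0"
proof -
  have "(\<lambda>h. h \<bullet> D) = (\<lambda>h. 0)"
    using differential_zero_maxmin[OF assms(2,1)] assms(3,4) unfolding gderiv_def by blast
  then have "D \<bullet> D = 0" by meson
  then show ?thesis by simp
qed

section \<open>Coercivity of the saddle gradient\<close>

text \<open>
  Taylor's formula along the segment from \<open>x\<close> to \<open>y\<close>: the slope of \<open>f\<close> grows at rate at least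
  \<open>k \<parallel>y - x\<parallel>\<^sup>2\<close>, and integrating once more gives the quadratic term.
\<close>
lemma second_order_lower_bound:
  fixes f :: "'a::real_inner \<Rightarrow> real"
  assumes "convex S"
    and G: "\<And>u. u \<in> S \<Longrightarrow> GDERIV f u :> G u"
    and H: "\<And>u. u \<in> S \<Longrightarrow> (G has_derivative H u) (at u)"
    and k: "\<And>u v. u \<in> S \<Longrightarrow> k * (norm v)\<^sup>2 \<le> v \<bullet> H u v"
    and "x \<in> S" "y \<in> S"
  shows "f x + (y - x) \<bullet> G x + k / 2 * (norm (y - x))\<^sup>2 \<le> f y"
proof -
  define v where "v = y - x"
  define g where "g s = x + s *\<^sub>R v" for s :: real
  have gS: "g s \<in> S" if "0 \<le> s" "s \<le> 1" for s
  proof -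
    have "g s = (1 - s) *\<^sub>R x + s *\<^sub>R y" by (simp add: g_def v_def algebra_simps)
    then show ?thesis using assms(1,5,6) that by (simp add: convex_alt)
  qed
  have dg: "(g has_derivative (\<lambda>h. h *\<^sub>R v)) (at s)" for s
    unfolding g_def by (auto intro!: derivative_eq_intros)
  have df: "((\<lambda>s. f (g s)) has_real_derivative v \<bullet> G (g s)) (at s)" if "0 \<le> s" "s \<le> 1" for s
    using has_derivative_compose[OF dg G[OF gS[OF that], unfolded gderiv_def]]
    by (simp add: has_field_derivative_def mult_commute_abs)
  have dG: "((\<lambda>s. v \<bullet> G (g s)) has_real_derivative v \<bullet> H (g s) v) (at s)"
    if "0 \<le> s" "s \<le> 1" for s
  proof -
    have l: "linear (H (g s))" using H[OF gS[OF that]] by (rule has_derivative_linear)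
    have "((\<lambda>s. v \<bullet> G (g s)) has_derivative (\<lambda>h. v \<bullet> H (g s) (h *\<^sub>R v))) (at s)"
      using has_derivative_compose[OF dg H[OF gS[OF that]]] by (rule has_derivative_inner_right)
    then show ?thesis
      unfolding has_field_derivative_def by (simp add: linear_scale[OF l] mult_commute_abs)
  qed
  have slope: "v \<bullet> G x + s * (k * (norm v)\<^sup>2) \<le> v \<bullet> G (g s)" if s: "0 \<le> s" "s \<le> 1" for s
  proof -
    have "v \<bullet> G (g 0) - 0 * (k * (norm v)\<^sup>2) \<le> v \<bullet> G (g s) - s * (k * (norm v)\<^sup>2)"
    proof (rule DERIV_nonneg_imp_nondecreasing[OF s(1)])
      fix r assume "0 \<le> r" "r \<le> s"
      with s have r: "0 \<le> r" "r \<le> 1" by auto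
      have "((\<lambda>s. v \<bullet> G (g s) - s * (k * (norm v)\<^sup>2)) has_real_derivative
          v \<bullet> H (g r) v - k * (norm v)\<^sup>2) (at r)"
        by (auto intro!: derivative_eq_intros dG r)
      with k[OF gS[OF r]]
      show "\<exists>d. ((\<lambda>s. v \<bullet> G (g s) - s * (k * (norm v)\<^sup>2)) has_real_derivative d) (at r) \<and> 0 \<le> d"
        by fastforce
    qed
    then show ?thesis by (simp add: g_def)
  qed
  define q where "q s = f (g s) - s * (v \<bullet> G x) - s\<^sup>2 / 2 * (k * (norm v)\<^sup>2)" for s :: real
  have "q 0 \<le> q 1"
  proof (rule DERIV_nonneg_imp_nondecreasing[of 0 1 q])
    fix r :: real assume r: "0 \<le> r" "r \<le> 1"
    have "(q has_real_derivative v \<bullet> G (g r) - v \<bullet> G x - r * (k * (norm v)\<^sup>2)) (at r)"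
      unfolding q_def by (auto intro!: derivative_eq_intros df r)
    with slope[OF r]
    show "\<exists>d. (q has_real_derivative d) (at r) \<and> 0 \<le> d" by (smt (verit))
  qed simp
  then show ?thesis by (simp add: q_def g_def v_def)
qed

text \<open>
  With \<open>g\<close> the saddle gradient at \<open>(x,z)\<close>, the quadratic lower bound for \<open>F(\<cdot>,z)\<close> and the upper bound
  for \<open>F(x,\<cdot>)\<close>, both expanded about the current point, add up to
  \<open>(p - p\<^sub>0) \<bullet> g \<ge> F(x,z\<^sub>0) - F(x\<^sub>0,z) + k/2 D\<^sup>2\<close>. Expanding about the saddle point instead, where the
  gradient vanishes, gives \<open>F(x,z\<^sub>0) - F(x\<^sub>0,z) \<ge> k/2 D\<^sup>2\<close>.
\<close>
lemma saddle_grad_coercive: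
  fixes F :: "(real ^ 'n) \<times> (real ^ 'm) \<Rightarrow> real"
  assumes "C2 F" and sad: "local_saddle_point F xs zs"
    and "(xs, zs) \<in> U" and "strongly_convex_concave_on U F"
    and Hx: "\<And>x z. (x, z) \<in> U \<Longrightarrow> loewner_le (mat kx) (hessian (\<lambda>x'. F (x', z)) x)"
    and Hz: "\<And>x z. (x, z) \<in> U \<Longrightarrow> loewner_le (hessian (\<lambda>z'. F (x, z')) z) (mat (- kz))"
    and "p \<in> U"
  shows "full_grad F (xs, zs) = 0"
    and "min kx kz * (norm (p - (xs, zs)))\<^sup>2 \<le> (p - (xs, zs)) \<bullet> saddle_grad F p"
proof -
  obtain x z where p: "p = (x, z)" by force
  obtain Ux Uz where U: "U = Ux \<times> Uz" and conv: "convex Ux" "convex Uz"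
    using assms(4) unfolding strongly_convex_concave_on_def by blast
  have mem: "x \<in> Ux" "xs \<in> Ux" "z \<in> Uz" "zs \<in> Uz" using assms(3,7) U p by auto
  let ?G = "gradient F"
  have G: "GDERIV F q :> ?G q" for q
    using \<open>C2 F\<close> unfolding C2_def by (blast intro: differentiable_imp_GDERIV_gradient)
  have fg: "full_grad F q = ?G q" for q using full_grad_eq_gradient[OF G] .
  define H where "H q = frechet_derivative ?G (at q)" for q
  have H: "(?G has_derivative H q) (at q)" for q
    using \<open>C2 F\<close> unfolding C2_def H_def frechet_derivative_works[symmetric] by blast
  have Gx: "GDERIV (\<lambda>x'. F (x', w)) u :> fst (?G (u, w))" for u w by (rule GDERIV_fst[OF G])
  have Gz: "GDERIV (\<lambda>z'. F (u, z')) w :> snd (?G (u, w))" for u w by (rule GDERIV_snd[OF G])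
  have dGx: "((\<lambda>u. fst (?G (u, w))) has_derivative (\<lambda>v. fst (H (u, w) (v, 0)))) (at u)" for u w
  proof -
    have "((\<lambda>u. (u, w)) has_derivative (\<lambda>h. (h, 0))) (at u)"
      by (auto intro!: derivative_eq_intros)
    from has_derivative_fst[OF has_derivative_compose[OF this H]] show ?thesis .
  qed
  have dGz: "((\<lambda>w. snd (?G (u, w))) has_derivative (\<lambda>v. snd (H (u, w) (0, v)))) (at w)" for u w
  proof -
    have "((\<lambda>w. (u, w)) has_derivative (\<lambda>h. (0, h))) (at w)"
      by (auto intro!: derivative_eq_intros)
    from has_derivative_snd[OF has_derivative_compose[OF this H]] show ?thesis .
  qed
  have kx: "kx * (norm v)\<^sup>2 \<le> v \<bullet> fst (H (u, w) (v, 0))" if "u \<in> Ux" "w \<in> Uz" for u w v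
    using Hx[of u w] that U hessian_mult_vec[OF Gx dGx]
    by (simp add: loewner_le_def mat_mult_vec dot_square_norm)
  have kz: "kz * (norm v)\<^sup>2 \<le> v \<bullet> - snd (H (u, w) (0, v))" if "u \<in> Ux" "w \<in> Uz" for u w v
    using Hz[of u w] that U hessian_mult_vec[OF Gz dGz]
    by (auto simp: loewner_le_def mat_mult_vec dot_square_norm dest!: spec[of _ v])
  have convex_x: "F (u, w) + (u' - u) \<bullet> fst (?G (u, w)) + kx / 2 * (norm (u' - u))\<^sup>2 \<le> F (u', w)"
    if "u \<in> Ux" "u' \<in> Ux" "w \<in> Uz" for u u' w
    using second_order_lower_bound[OF conv(1) Gx dGx kx] that by simp
  have concave_z: "- F (u, w) + (w' - w) \<bullet> - snd (?G (u, w)) + kz / 2 * (norm (w' - w))\<^sup>2 \<le> - F (u, w')"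
    if "u \<in> Ux" "w \<in> Uz" "w' \<in> Uz" for u w w'
    using second_order_lower_bound[OF conv(2) GDERIV_minus[OF Gz] has_derivative_minus[OF dGz] kz] that
    by simp
  obtain Nx Nz where N: "open Nx" "open Nz" "xs \<in> Nx" "zs \<in> Nz"
    and ineq: "\<And>x z. x \<in> Nx \<Longrightarrow> z \<in> Nz \<Longrightarrow> F (xs, z) \<le> F (xs, zs) \<and> F (xs, zs) \<le> F (x, zs)"
    using sad unfolding local_saddle_point_def by blast
  have "fst (?G (xs, zs)) = 0"
    using N ineq by (intro local_min_imp_GDERIV_zero[OF N(1,3) _ Gx]) blast
  moreover have "- snd (?G (xs, zs)) = 0"
    using N ineq by (intro local_min_imp_GDERIV_zero[OF N(2,4) _ GDERIV_minus[OF Gz]]) force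
  ultimately have zero: "?G (xs, zs) = 0" by (simp add: prod_eq_iff)
  then show "full_grad F (xs, zs) = 0" by (simp add: fg)
  have sg: "saddle_grad F (x, z) = (fst (?G (x, z)), - snd (?G (x, z)))"
    using fg[of "(x, z)"] by (auto simp: saddle_grad_def full_grad_def prod_eq_iff)
  have "kx * (norm (x - xs))\<^sup>2 + kz * (norm (z - zs))\<^sup>2
      \<le> (x - xs) \<bullet> fst (?G (x, z)) - (z - zs) \<bullet> snd (?G (x, z))"
    using convex_x[of x xs z] convex_x[of xs x zs] concave_z[of x z zs] concave_z[of xs zs z] mem zero
    by (simp add: norm_minus_commute inner_diff_left inner_diff_right)
  moreover have "min kx kz * (norm (x - xs))\<^sup>2 \<le> kx * (norm (x - xs))\<^sup>2"
    "min kx kz * (norm (z - zs))\<^sup>2 \<le> kz * (norm (z - zs))\<^sup>2"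
    by (auto intro!: mult_right_mono)
  ultimately show "min kx kz * (norm (p - (xs, zs)))\<^sup>2 \<le> (p - (xs, zs)) \<bullet> saddle_grad F p"
    unfolding p sg by (simp add: norm_Pair inner_prod_def distrib_left)
qed

section \<open>Fixed-time extinction for scalar differential inequalities\<close>

lemma decreasing_of_deriv_nonpos:
  fixes u :: "real \<Rightarrow> real"
  assumes "s \<le> t"
    and "\<And>r. s \<le> r \<Longrightarrow> r \<le> t \<Longrightarrow> (u has_real_derivative u' r) (at r within {s..t})"
    and "\<And>r. s < r \<Longrightarrow> r < t \<Longrightarrow> u' r \<le> 0"
  shows "u t \<le> u s"
proof (cases "s = t")
  case False
  with assms(1) have "s < t" by simp
  from mvt_simple[OF this, of u "\<lambda>r. (*) (u' r)"] assms(2)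
  obtain r where "r \<in> {s<..<t}" "u t - u s = u' r * (t - s)"
    unfolding has_field_derivative_def by blast
  with assms(3)[of r] \<open>s < t\<close> have "u t - u s \<le> 0" by (simp add: mult_nonpos_nonneg)
  then show ?thesis by simp
qed simp

text \<open>
  Separation of variables for \<open>u' \<le> - C u\<^sup>1\<^sup>-\<^sup>e\<close>: the function \<open>u\<^sup>e / e\<close> has derivative at most \<open>- C\<close>.
  The quotient by \<open>e\<close> covers both signs of \<open>e\<close> at once: extinction in finite time for \<open>e > 0\<close>,
  and for \<open>e < 0\<close> a bound that does not involve the initial value.
\<close>
lemma powr_decay:
  fixes u :: "real \<Rightarrow> real"
  assumes "e \<noteq> 0" "s \<le> t"
    and du: "\<And>r. s \<le> r \<Longrightarrow> r \<le> t \<Longrightarrow> (u has_real_derivative u' r) (at r within {s..t})"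
    and pos: "\<And>r. s \<le> r \<Longrightarrow> r \<le> t \<Longrightarrow> 0 < u r"
    and decay: "\<And>r. s \<le> r \<Longrightarrow> r \<le> t \<Longrightarrow> u' r \<le> - C * u r powr (1 - e)"
  shows "u t powr e / e \<le> u s powr e / e - C * (t - s)"
proof -
  let ?h = "\<lambda>r. u r powr e / e + C * r"
  let ?d = "\<lambda>r. u r powr (e - 1) * u' r + C"
  have "?h t \<le> ?h s"
  proof (rule decreasing_of_deriv_nonpos[OF \<open>s \<le> t\<close>])
    fix r assume r: "s \<le> r" "r \<le> t"
    have "((\<lambda>r. u r powr e) has_real_derivative e * u r powr (e - 1) * u' r) (at r within {s..t})"
      using DERIV_chain2[OF has_real_derivative_powr[OF pos[OF r]] du[OF r]] by simp
    from DERIV_add[OF DERIV_cdivide[OF this, of e] DERIV_cmult_Id]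
    show "(?h has_real_derivative ?d r) (at r within {s..t})"
      using \<open>e \<noteq> 0\<close> by simp
  next
    fix r assume "s < r" "r < t"
    then have r: "s \<le> r" "r \<le> t" by auto
    have "u r powr (e - 1) * u' r \<le> u r powr (e - 1) * (- C * u r powr (1 - e))"
      using decay[OF r] by (intro mult_left_mono) auto
    also have "\<dots> = - C * (u r powr (e - 1) * u r powr (1 - e))" by simp
    also have "\<dots> = - C"
      using pos[OF r] by (simp flip: powr_add)
    finally show "?d r \<le> 0" by simp
  qed
  then show ?thesis by (simp add: algebra_simps)
qed

text \<open>
  The two summands of the time bound are those of two phases: the superlinear decay with exponent
  \<open>1 + \<beta>\<close> brings \<open>u\<close> below \<open>\<delta>\<close> from any height, and then the sublinear decay with exponent
  \<open>1 - \<alpha>\<close> extinguishes it.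
\<close>
lemma fixed_time_extinction:
  fixes u :: "real \<Rightarrow> real"
  assumes "0 < \<alpha>" "0 < \<beta>" "0 < K1" "0 < K2" "0 < \<delta>"
    and du: "\<And>r. 0 \<le> r \<Longrightarrow> (u has_real_derivative u' r) (at r within {0..})"
    and nonneg: "\<And>r. 0 \<le> r \<Longrightarrow> 0 \<le> u r"
    and decr: "\<And>r. 0 \<le> r \<Longrightarrow> u' r \<le> 0"
    and far: "\<And>r. 0 \<le> r \<Longrightarrow> 0 < u r \<Longrightarrow> u' r \<le> - K2 * u r powr (1 + \<beta>)"
    and near: "\<And>r. 0 \<le> r \<Longrightarrow> 0 < u r \<Longrightarrow> u r \<le> \<delta> \<Longrightarrow> u' r \<le> - K1 * u r powr (1 - \<alpha>)"
    and t: "\<delta> powr - \<beta> / (\<beta> * K2) + \<delta> powr \<alpha> / (\<alpha> * K1) \<le> t"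
  shows "u t = 0"
proof (rule ccontr)
  define T1 where "T1 = \<delta> powr - \<beta> / (\<beta> * K2)"
  have T1: "0 \<le> T1" "T1 + \<delta> powr \<alpha> / (\<alpha> * K1) \<le> t"
    using assms(1-5) t unfolding T1_def by auto
  moreover have "0 \<le> \<delta> powr \<alpha> / (\<alpha> * K1)" using assms(1-5) by simp
  ultimately have T1t: "T1 \<le> t" by linarith
  have du': "(u has_real_derivative u' r) (at r within {a..b})" if "0 \<le> a" "a \<le> r" for a b r
    using du[of r] that by (auto intro: has_field_derivative_subset)
  have mono: "u b \<le> u a" if "0 \<le> a" "a \<le> b" for a b
    using that by (intro decreasing_of_deriv_nonpos[of a b u u'] du' decr) auto
  assume "u t \<noteq> 0"
  then have "0 < u t" using nonneg[of t] T1(1) T1t by fastforce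
  then have pos: "0 < u r" if "0 \<le> r" "r \<le> t" for r using mono[OF that] by linarith
  have "u T1 powr - \<beta> / - \<beta> \<le> u 0 powr - \<beta> / - \<beta> - K2 * (T1 - 0)"
    using assms(2) T1 T1t far pos by (intro powr_decay[where u' = u'] du') auto
  moreover have "0 < u 0 powr - \<beta> / \<beta>" using pos[of 0] T1 T1t assms(2) by simp
  moreover have "K2 * T1 = \<delta> powr - \<beta> / \<beta>" using assms(4) by (simp add: T1_def)
  ultimately have "\<delta> powr - \<beta> / \<beta> < u T1 powr - \<beta> / \<beta>"
    unfolding divide_minus_right diff_0_right by linarith
  then have "\<delta> powr - \<beta> < u T1 powr - \<beta>"
    using assms(2) by (simp add: divide_less_cancel)
  then have u1: "u T1 < \<delta>"
    using assms(2,5) pos[OF T1(1) T1t] powr_mono2'[of "-\<beta>" \<delta> "u T1"] by (smt (verit))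
  have below: "u r \<le> \<delta>" if "T1 \<le> r" for r using mono[OF T1(1) that] u1 by linarith
  have "u t powr \<alpha> / \<alpha> \<le> u T1 powr \<alpha> / \<alpha> - K1 * (t - T1)"
    using assms(1) T1 T1t near pos below by (intro powr_decay[where u' = u'] du') auto
  moreover have "u T1 powr \<alpha> / \<alpha> < \<delta> powr \<alpha> / \<alpha>"
    using u1 pos[OF T1(1) T1t] assms(1) by (simp add: divide_strict_right_mono powr_less_mono2)
  moreover have "\<delta> powr \<alpha> / \<alpha> \<le> K1 * (t - T1)"
  proof -
    have "\<delta> powr \<alpha> / \<alpha> = K1 * (\<delta> powr \<alpha> / (\<alpha> * K1))" using assms(3) by simp
    also have "\<dots> \<le> K1 * (t - T1)" using T1 assms(3) by (intro mult_left_mono) auto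
    finally show ?thesis .
  qed
  moreover have "0 \<le> u t powr \<alpha> / \<alpha>" using assms(1) by simp
  ultimately show False by linarith
qed

section \<open>The squared distance along the flow\<close>

lemma sq_norm_has_derivative:
  assumes "(w has_vector_derivative w') (at t within S)"
  shows "((\<lambda>t. (norm (w t - p))\<^sup>2) has_real_derivative 2 * ((w t - p) \<bullet> w')) (at t within S)"
proof -
  have "((\<lambda>t. w t - p) has_derivative (\<lambda>h. h *\<^sub>R w')) (at t within S)"
    using assms unfolding has_vector_derivative_def by (auto intro!: derivative_eq_intros)
  from has_derivative_inner[OF this this]
  have "((\<lambda>t. (norm (w t - p))\<^sup>2) has_derivative
      (\<lambda>h. (w t - p) \<bullet> h *\<^sub>R w' + h *\<^sub>R w' \<bullet> (w t - p))) (at t within S)"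
    unfolding power2_norm_eq_inner .
  moreover have "(\<lambda>h. (w t - p) \<bullet> h *\<^sub>R w' + h *\<^sub>R w' \<bullet> (w t - p)) = (*) (2 * ((w t - p) \<bullet> w'))"
    by (simp add: fun_eq_iff inner_commute)
  ultimately show ?thesis unfolding has_field_derivative_def by simp
qed

lemma trajectory_sq_dist_deriv:
  assumes "trajectory f w" "0 \<le> t"
  shows "((\<lambda>t. (norm (w t - p))\<^sup>2) has_real_derivative 2 * ((w t - p) \<bullet> f (w t))) (at t within {0..})"
  using assms unfolding trajectory_def by (blast intro: sq_norm_has_derivative)

text \<open>
  A trajectory that left the ball would do so at a first exit time; up to that time its distance to
  the centre is nonincreasing, hence stays below the initial distance, which is less than \<open>r\<close>.
\<close>
lemma ball_invariant:
  assumes tr: "trajectory f w"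
    and inward: "\<And>q. q \<in> ball p r \<Longrightarrow> (q - p) \<bullet> f q \<le> 0"
    and "w 0 \<in> ball p r" "0 \<le> t"
  shows "w t \<in> ball p r"
proof (rule ccontr)
  let ?u = "\<lambda>t. (norm (w t - p))\<^sup>2"
  assume out: "w t \<notin> ball p r"
  have "0 < r" using \<open>w 0 \<in> ball p r\<close> zero_le_dist[of p "w 0"] by (auto simp del: zero_le_dist)
  have in_iff: "w s \<in> ball p r \<longleftrightarrow> ?u s < r\<^sup>2" for s
    using \<open>0 < r\<close> by (auto simp: dist_norm norm_minus_commute power_strict_mono
        intro: power_less_imp_less_base)
  have du: "(?u has_real_derivative 2 * ((w s - p) \<bullet> f (w s))) (at s within A)"
    if "0 \<le> s" "A \<subseteq> {0..}" for s A
    using trajectory_sq_dist_deriv[OF tr that(1)] that(2) by (rule has_field_derivative_subset)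
  have cont: "continuous_on {0..t} ?u"
    by (rule DERIV_continuous_on[where D = "\<lambda>s. 2 * ((w s - p) \<bullet> f (w s))"]) (auto intro!: du)
  define E where "E = {s \<in> {0..t}. r\<^sup>2 \<le> ?u s}"
  have "closed E"
    using continuous_closed_preimage[OF cont, of "{r\<^sup>2..}"]
    by (simp add: E_def vimage_def Int_def)
  have "t \<in> E" using out in_iff[of t] \<open>0 \<le> t\<close> by (simp add: E_def)
  have "bdd_below E" unfolding E_def by (rule bdd_belowI[of _ 0]) auto
  define s where "s = Inf E"
  have "s \<in> E"
    unfolding s_def using \<open>t \<in> E\<close> \<open>closed E\<close> \<open>bdd_below E\<close> by (intro closed_contains_Inf) auto
  then have s: "0 \<le> s" "s \<le> t" "r\<^sup>2 \<le> ?u s" unfolding E_def by auto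
  have before: "w q \<in> ball p r" if "0 \<le> q" "q < s" for q
  proof (rule ccontr)
    assume "w q \<notin> ball p r"
    then have "q \<in> E" using that s in_iff[of q] by (simp add: E_def)
    then show False using cInf_lower[OF _ \<open>bdd_below E\<close>] that unfolding s_def by force
  qed
  have "?u s \<le> ?u 0"
  proof (rule decreasing_of_deriv_nonpos[OF s(1)])
    fix q assume "0 < q" "q < s"
    then show "2 * ((w q - p) \<bullet> f (w q)) \<le> 0" using inward[OF before[of q]] by simp
  qed (auto intro!: du)
  then show False using \<open>w 0 \<in> ball p r\<close> in_iff[of 0] s(3) by linarith
qed

text \<open>
  Both summands of the flow pull towards \<open>q\<close>, so the pull is at least that of either one, \<open>c / n\<^sup>e\<close>
  times the saddle gradient, with the other dropped. A bound of \<open>n\<^sup>e\<close> by a multiple of \<open>D\<^sup>e\<close> means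
  \<open>n \<le> M D\<close> for \<open>e > 0\<close>, but \<open>n \<ge> M D\<close> for \<open>e < 0\<close>.
\<close>
lemma saddle_flow_field_decay:
  fixes F :: "'a::real_inner \<times> 'b::real_inner \<Rightarrow> real" and p1 p2 :: real
  defines "a \<equiv> (p1 - 2) / (p1 - 1)" and "b \<equiv> (p2 - 2) / (p2 - 1)"
  assumes "0 < c1" "0 < c2" "0 < k" "0 < M" "p \<noteq> q"
    and coercive: "k * (norm (p - q))\<^sup>2 \<le> (p - q) \<bullet> saddle_grad F p"
    and ce: "(c, e) = (c1, a) \<or> (c, e) = (c2, b)"
    and bound: "norm (full_grad F p) powr e \<le> (M * norm (p - q)) powr e"
  shows "2 * ((p - q) \<bullet> saddle_flow_field c1 c2 p1 p2 F p)
      \<le> - (2 * c * k * M powr - e) * ((norm (p - q))\<^sup>2) powr (1 - e / 2)"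
proof -
  let ?n = "norm (full_grad F p)" and ?D = "norm (p - q)" and ?i = "(p - q) \<bullet> saddle_grad F p"
  have D: "0 < ?D" using \<open>p \<noteq> q\<close> by simp
  have i: "0 < ?i" using coercive D \<open>0 < k\<close>
    by (meson less_le_trans mult_pos_pos zero_less_power)
  then have "saddle_grad F p \<noteq> 0" by auto
  then have n: "full_grad F p \<noteq> 0" using norm_saddle_grad[of F p] by auto
  have eq: "(p - q) \<bullet> saddle_flow_field c1 c2 p1 p2 F p
      = - (c1 / ?n powr a * ?i + c2 / ?n powr b * ?i)"
    using n by (simp add: saddle_flow_field_def a_def b_def inner_diff_right)
  have "c / ?n powr e * ?i \<le> c1 / ?n powr a * ?i + c2 / ?n powr b * ?i"
    using ce i assms(3,4) by auto
  moreover have "c * k * M powr - e * (?D\<^sup>2) powr (1 - e / 2) \<le> c / ?n powr e * ?i"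
  proof -
    have c: "0 < c" using ce assms(3,4) by auto
    have "(?D\<^sup>2) powr (1 - e / 2) = (?D powr 2) powr (1 - e / 2)"
      using D by (simp add: powr_numeral)
    also have "\<dots> = ?D powr (2 - e)"
      unfolding powr_powr by (simp add: right_diff_distrib)
    also have "\<dots> = ?D\<^sup>2 * ?D powr - e"
      using D by (simp add: powr_diff powr_minus divide_inverse powr_numeral)
    finally have "c * k * M powr - e * (?D\<^sup>2) powr (1 - e / 2)
        = c / (M * ?D) powr e * (k * ?D\<^sup>2)"
      using D \<open>0 < M\<close> by (simp add: powr_mult powr_minus field_simps)
    also have "\<dots> \<le> c / ?n powr e * ?i"
      using coercive i c n D \<open>0 < k\<close> \<open>0 < M\<close> bound
      by (intro mult_mono divide_left_mono) auto
    finally show ?thesis .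
  qed
  ultimately have "c * k * M powr - e * (?D\<^sup>2) powr (1 - e / 2)
      \<le> c1 / ?n powr a * ?i + c2 / ?n powr b * ?i" by (rule order_trans[rotated])
  then have "2 * - (c1 / ?n powr a * ?i + c2 / ?n powr b * ?i)
      \<le> - (2 * (c * k * M powr - e * (?D\<^sup>2) powr (1 - e / 2)))" by simp
  then show ?thesis unfolding eq by (simp only: mult.assoc minus_mult_left[symmetric])
qed

section \<open>Convergence in fixed time\<close>

theorem theorem6:
  fixes F :: "(real ^ 'n) \<times> (real ^ 'm) \<Rightarrow> real"
    and xs :: "real ^ 'n" and zs :: "real ^ 'm"
    and U :: "((real ^ 'n) \<times> (real ^ 'm)) set"
    and kx kz c1 c2 p1 p2 :: real
  assumes "C2 F"
    and "local_saddle_point F xs zs"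
    and "open U" and "(xs, zs) \<in> U"
    and "strongly_convex_concave_on U F"
    and "kx > 0" and "kz > 0"
    and "\<And>x z. (x, z) \<in> U \<Longrightarrow> loewner_le (mat kx) (hessian (\<lambda>x'. F (x', z)) x)"
    and "\<And>x z. (x, z) \<in> U \<Longrightarrow> loewner_le (hessian (\<lambda>z'. F (x, z')) z) (mat (- kz))"
    and "c1 > 0" and "c2 > 0" and "p1 > 2" and "1 < p2" and "p2 < 2"
  shows "\<exists>T\<ge>0.
      (\<forall>w. trajectory (saddle_flow_field c1 c2 p1 p2 F) w \<and> w 0 \<in> U \<and> (\<forall>t\<ge>0. w t \<in> U)
        \<longrightarrow> (\<forall>t\<ge>T. w t = (xs, zs))) \<and>
      (\<forall>w r. trajectory (saddle_flow_field c1 c2 p1 p2 F) w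
          \<and> ball (xs, zs) r \<subseteq> U \<and> w 0 \<in> ball (xs, zs) r
        \<longrightarrow> (\<forall>t\<ge>T. w t = (xs, zs))) \<and>
      (U = UNIV \<longrightarrow>
        (\<forall>w. trajectory (saddle_flow_field c1 c2 p1 p2 F) w \<longrightarrow> (\<forall>t\<ge>T. w t = (xs, zs))))"
proof -
  let ?f = "saddle_flow_field c1 c2 p1 p2 F" and ?s = "(xs, zs)"
  define k where "k = min kx kz"
  define a where "a = (p1 - 2) / (p1 - 1)"
  define b where "b = (p2 - 2) / (p2 - 1)"
  have k: "0 < k" using assms(6,7) by (simp add: k_def)
  have a: "0 < a" using assms(12) by (simp add: a_def)
  have b: "b < 0" using assms(13,14) by (simp add: b_def divide_neg_pos)
  have zero: "full_grad F ?s = 0"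
    by (rule saddle_grad_coercive(1)[OF assms(1,2,4,5) _ _ assms(4)]) (use assms(8,9) in auto)
  have coercive: "k * (norm (p - ?s))\<^sup>2 \<le> (p - ?s) \<bullet> saddle_grad F p" if "p \<in> U" for p
    unfolding k_def
    by (rule saddle_grad_coercive(2)[OF assms(1,2,4,5)]) (use assms(8,9) that in auto)
  have grad_lower: "k * norm (p - ?s) \<le> norm (full_grad F p)" if "p \<in> U" for p
  proof (cases "p = ?s")
    case False
    have "k * norm (p - ?s) * norm (p - ?s) \<le> (p - ?s) \<bullet> saddle_grad F p"
      using coercive[OF that] by (simp add: power2_eq_square mult.assoc)
    also have "\<dots> \<le> norm (p - ?s) * norm (full_grad F p)"
      using norm_cauchy_schwarz[of "p - ?s" "saddle_grad F p"] by (simp add: norm_saddle_grad)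
    finally show ?thesis using False by (simp add: mult.commute mult_le_cancel_left)
  qed simp
  obtain L \<rho> where L: "0 < L" and "0 < \<rho>"
    and grad_upper: "\<And>p. norm (p - ?s) \<le> \<rho> \<Longrightarrow> norm (full_grad F p) \<le> L * norm (p - ?s)"
  proof -
    have "full_grad F = gradient F"
      using assms(1) unfolding C2_def
      by (blast intro: full_grad_eq_gradient differentiable_imp_GDERIV_gradient)
    then have "full_grad F differentiable (at ?s)"
      using assms(1) unfolding C2_def by simp
    then obtain G' where G': "(full_grad F has_derivative G') (at ?s)"
      unfolding differentiable_def by blast
    then have lin: "bounded_linear G'" by (rule has_derivative_bounded_linear)
    (* Relative error 1 in the linear approximation of the gradient makes L = onorm G' + 1 work. *)
    obtain d where d: "0 < d" and approx: "\<And>p. norm (p - ?s) < d \<Longrightarrow>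
        norm (full_grad F p - full_grad F ?s - G' (p - ?s)) \<le> 1 * norm (p - ?s)"
      using G' unfolding has_derivative_at_alt by (meson zero_less_one)
    have "norm (full_grad F p) \<le> (onorm G' + 1) * norm (p - ?s)" if "norm (p - ?s) \<le> d / 2" for p
    proof -
      have "norm (full_grad F p - G' (p - ?s)) \<le> norm (p - ?s)"
        using approx[of p] that d zero by simp
      moreover have "norm (G' (p - ?s)) \<le> onorm G' * norm (p - ?s)" by (rule onorm[OF lin])
      ultimately show ?thesis
        using norm_triangle_sub[of "full_grad F p" "G' (p - ?s)"] by (simp add: distrib_right)
    qed
    with that[of "onorm G' + 1" "d / 2"] d onorm_pos_le[OF lin] show thesis by auto
  qed
  define K1 where "K1 = 2 * c1 * k * L powr - a"
  define K2 where "K2 = 2 * c2 * k * k powr - b"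
  have C: "0 < K1" "0 < K2" using assms(10,11) k L by (simp_all add: K1_def K2_def)
  have far: "2 * ((p - ?s) \<bullet> ?f p) \<le> - K2 * ((norm (p - ?s))\<^sup>2) powr (1 - b / 2)"
    if "p \<in> U" "p \<noteq> ?s" for p
    unfolding K2_def
    by (rule saddle_flow_field_decay)
      (use assms(10,11) k b that coercive grad_lower[OF that(1)] in
        \<open>auto simp: b_def intro!: powr_mono2'\<close>)
  have near: "2 * ((p - ?s) \<bullet> ?f p) \<le> - K1 * ((norm (p - ?s))\<^sup>2) powr (1 - a / 2)"
    if "p \<in> U" "p \<noteq> ?s" "norm (p - ?s) \<le> \<rho>" for p
    unfolding K1_def
    by (rule saddle_flow_field_decay)
      (use assms(10,11) k a L that coercive grad_upper[OF that(3)] in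
        \<open>auto simp: a_def intro!: powr_mono2\<close>)
  have inward: "(p - ?s) \<bullet> ?f p \<le> 0" if "p \<in> U" for p
  proof (cases "p = ?s")
    case False
    have "2 * ((p - ?s) \<bullet> ?f p) \<le> - K2 * ((norm (p - ?s))\<^sup>2) powr (1 - b / 2)"
      by (rule far[OF that False])
    also have "\<dots> \<le> 0" using C by simp
    finally show ?thesis by simp
  qed simp
  (* The time bound of the extinction lemma for u = D^2, which halves the exponents a and -b. *)
  define T where "T = (\<rho>\<^sup>2) powr - (- b / 2) / (- b / 2 * K2) + (\<rho>\<^sup>2) powr (a / 2) / (a / 2 * K1)"
  have "0 \<le> T" unfolding T_def using a b C \<open>0 < \<rho>\<close>
    by (intro add_nonneg_nonneg divide_nonneg_pos mult_pos_pos) auto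
  have inside: "w t = ?s" if tr: "trajectory ?f w" and wU: "\<And>t. 0 \<le> t \<Longrightarrow> w t \<in> U" and "T \<le> t" for w t
  proof -
    have "(norm (w t - ?s))\<^sup>2 = 0"
    proof (rule fixed_time_extinction[of "a / 2" "- b / 2" K1 K2 "\<rho>\<^sup>2"
          "\<lambda>t. (norm (w t - ?s))\<^sup>2" "\<lambda>t. 2 * ((w t - ?s) \<bullet> ?f (w t))"])
      fix r :: real assume r: "0 \<le> r"
      show "2 * ((w r - ?s) \<bullet> ?f (w r)) \<le> 0" using inward[OF wU[OF r]] by simp
      assume "0 < (norm (w r - ?s))\<^sup>2"
      then have ne: "w r \<noteq> ?s" by auto
      from far[OF wU[OF r] ne]
      show "2 * ((w r - ?s) \<bullet> ?f (w r)) \<le> - K2 * ((norm (w r - ?s))\<^sup>2) powr (1 + - b / 2)" by simp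
      assume "(norm (w r - ?s))\<^sup>2 \<le> \<rho>\<^sup>2"
      then have "norm (w r - ?s) \<le> \<rho>" using \<open>0 < \<rho>\<close> by (auto intro: power2_le_imp_le)
      from near[OF wU[OF r] ne this]
      show "2 * ((w r - ?s) \<bullet> ?f (w r)) \<le> - K1 * ((norm (w r - ?s))\<^sup>2) powr (1 - a / 2)" .
    qed (use a b C \<open>0 < \<rho>\<close> \<open>T \<le> t\<close> in \<open>auto simp: T_def intro: trajectory_sq_dist_deriv[OF tr]\<close>)
    then show ?thesis by simp
  qed
  have in_ball: "w t = ?s"
    if "trajectory ?f w" "ball ?s r \<subseteq> U" "w 0 \<in> ball ?s r" "T \<le> t" for w r t
  proof (rule inside[OF that(1) _ that(4)])
    fix t :: real assume "0 \<le> t"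
    then have "w t \<in> ball ?s r"
      using that(2) by (intro ball_invariant[OF that(1) _ that(3)] inward) blast
    then show "w t \<in> U" using that(2) by blast
  qed
  show ?thesis
  proof (intro exI[of _ T] conjI allI impI)
    show "0 \<le> T" by fact
  next
    fix w t
    assume "trajectory ?f w \<and> w 0 \<in> U \<and> (\<forall>t\<ge>0. w t \<in> U)" "T \<le> t"
    then show "w t = ?s" by (intro inside[of w]) simp_all
  next
    fix w r t
    assume "trajectory ?f w \<and> ball ?s r \<subseteq> U \<and> w 0 \<in> ball ?s r" "T \<le> t"
    then show "w t = ?s" by (intro in_ball[of w r]) simp_all
  next
    fix w t
    assume "U = UNIV" "trajectory ?f w" "T \<le> t"
    then show "w t = ?s" by (intro inside[of w]) simp_all
  qed
qed

end
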